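(* Let $X$ be a half-synchronized system. Then $(X,\sigma)$ is mixing if and only if $(X,\sigma)$ has strong property $P$.
   Context: Let $A$ be a finite alphabet and give $A^{\mathbb{Z}}$ the product topology of the discrete topology on $A$. The shift map is $\sigma((a_i)_{i\in\mathbb{Z}})=(a_{i+1})_{i\in\mathbb{Z}}$. A subshift is a nonempty closed $\sigma$-invariant subset $X\subseteq A^{\mathbb{Z}}$, with $\sigma$ restricted to it. Its language $\mathcal{L}(X)$ is the set of finite words occurring as consecutive entries in some point of $X$. The length of a word $w$ is $|w|$. For a compact metric space $X$, a homeomorphism $T:X\to X$ and nonempty open sets $U,V\subseteq X$ put $N(U,V)=\{n\in\mathbb{Z}: U\cap T^{-n}V\neq\emptyset\}$. $(X,T)$ is transitive if $N(U,V)\ne\emptyset$ for all nonempty open $U,V$, and mixing if $N(U,V)$ is cofinite for all nonempty open $U,V$. Strong property $P$: $(X,T)$ has strong property $P$ if for any finite list of nonempty open sets $U_1,\ldots,U_n$ in $X$ there exists $N\in\mathbb{N}$ (a positive integer) such that for every $k\ge 2$ and every $s=(s(1),\ldots,s(k))\in\{1,\ldots,n\}^k$ there exists $x\in X$ with $x\in U_{s(1)}\cap T^{-N}U_{s(2)}\cap\cdots\cap T^{-(k-1)N}U_{s(k)}$. Rays: for a point $x$ of a subshift $X$, the left ray of $x$ is $x_-=x_{(-\infty,0]}$ and the right ray is $x_+=x_{(0,\infty)}$; $X^-$ and $X^+$ denote the sets of left and right rays of points of $X$. A left ray $x_-$ is (left) transitive if every word of $\mathcal{L}(X)$ occurs in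 $x_-$. For $\eta$ a word in $\mathcal{L}(X)$ or a left ray, the follower set is $\omega_+(\eta)=\{y_+\in X^+: \eta y_+ \text{ is admissible}\}$, where admissible means that $\eta y_+$ occurs in a point of $X$. Half-synchronized: a transitive subshift $X$ is half-synchronized if there are a word $m\in\mathcal{L}(X)$ (called a half-synchronizing word) and a left transitive ray $x_-\in X^-$ such that $x_{-|m|+1}\cdots x_0=m$ and $\omega_+(x_-)=\omega_+(m)$. *)

theory Defs
  imports "HOL-Analysis.Analysis"
begin

section \<open>Topological dynamics\<close>

text \<open>
  A dynamical system is a topology \<open>\<tau>\<close> together with a self-map \<open>T\<close>. The definitions below are
  meant for homeomorphisms of compact metrizable spaces; lemma \<open>subshift_system\<close> shows that
  subshifts are of this kind.
\<close>

text \<open>\<open>iter_vimage \<tau> T n V\<close> is \<open>T\<^sup>-\<^sup>n V\<close> for an integer \<open>n\<close> and a subset \<open>V\<close> of the space. For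
  negative \<open>n\<close> it is the forward image under the iterate of order \<open>- n\<close>, which is the right set
  because \<open>T\<close> is a bijection of the space.\<close>

definition iter_vimage :: "'b topology \<Rightarrow> ('b \<Rightarrow> 'b) \<Rightarrow> int \<Rightarrow> 'b set \<Rightarrow> 'b set" where
  "iter_vimage \<tau> T n V =
     (if 0 \<le> n then {x \<in> topspace \<tau>. (T ^^ nat n) x \<in> V} else (T ^^ nat (- n)) ` V)"

definition hitting_times :: "'b topology \<Rightarrow> ('b \<Rightarrow> 'b) \<Rightarrow> 'b set \<Rightarrow> 'b set \<Rightarrow> int set" where
  "hitting_times \<tau> T U V = {n. U \<inter> iter_vimage \<tau> T n V \<noteq> {}}"

definition transitive_system :: "'b topology \<Rightarrow> ('b \<Rightarrow> 'b) \<Rightarrow> bool" where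
  "transitive_system \<tau> T \<longleftrightarrow>
     (\<forall>U V. openin \<tau> U \<and> U \<noteq> {} \<and> openin \<tau> V \<and> V \<noteq> {} \<longrightarrow> hitting_times \<tau> T U V \<noteq> {})"

definition mixing_system :: "'b topology \<Rightarrow> ('b \<Rightarrow> 'b) \<Rightarrow> bool" where
  "mixing_system \<tau> T \<longleftrightarrow>
     (\<forall>U V. openin \<tau> U \<and> U \<noteq> {} \<and> openin \<tau> V \<and> V \<noteq> {} \<longrightarrow> finite (- hitting_times \<tau> T U V))"

definition strong_property_P :: "'b topology \<Rightarrow> ('b \<Rightarrow> 'b) \<Rightarrow> bool" where
  "strong_property_P \<tau> T \<longleftrightarrow>
     (\<forall>(n::nat) (U :: nat \<Rightarrow> 'b set).
        (\<forall>i\<in>{1..n}. openin \<tau> (U i) \<and> U i \<noteq> {}) \<longrightarrow>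
        (\<exists>N::nat. N \<ge> 1 \<and>
           (\<forall>(k::nat) (s :: nat \<Rightarrow> nat). k \<ge> 2 \<and> (\<forall>j\<in>{1..k}. s j \<in> {1..n}) \<longrightarrow>
              (\<exists>x\<in>topspace \<tau>. \<forall>j\<in>{1..k}. (T ^^ ((j - 1) * N)) x \<in> U (s j)))))"


section \<open>Subshifts\<close>

definition full_shift :: "'a set \<Rightarrow> (int \<Rightarrow> 'a) topology" where
  "full_shift A = product_topology (\<lambda>_. discrete_topology A) UNIV"

definition shift :: "(int \<Rightarrow> 'a) \<Rightarrow> (int \<Rightarrow> 'a)" where
  "shift x = (\<lambda>i. x (i + 1))"

text \<open>Invariance is \<open>\<sigma>(X) = X\<close>, so that the shift restricts to a homeomorphism of \<open>X\<close>.\<close>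

definition subshift :: "'a set \<Rightarrow> (int \<Rightarrow> 'a) set \<Rightarrow> bool" where
  "subshift A X \<longleftrightarrow> X \<noteq> {} \<and> closedin (full_shift A) X \<and> shift ` X = X"

abbreviation subshift_topology :: "'a set \<Rightarrow> (int \<Rightarrow> 'a) set \<Rightarrow> (int \<Rightarrow> 'a) topology" where
  "subshift_topology A X \<equiv> subtopology (full_shift A) X"

lemma topspace_full_shift: "topspace (full_shift A) = {x. range x \<subseteq> A}"
  by (auto simp: full_shift_def PiE_def Pi_def)

lemma continuous_map_shift: "continuous_map (full_shift A) (full_shift A) shift"
  unfolding full_shift_def shift_def continuous_map_componentwise_UNIV
  by (auto intro: continuous_map_product_projection)

lemma continuous_map_unshift: "continuous_map (full_shift A) (full_shift A) (\<lambda>x i. x (i - 1))"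
  unfolding full_shift_def continuous_map_componentwise_UNIV
  by (auto intro: continuous_map_product_projection)

lemma subshift_system:
  assumes "finite A" "subshift A X"
  shows "topspace (subshift_topology A X) = X"
    and "compact_space (subshift_topology A X)"
    and "metrizable_space (subshift_topology A X)"
    and "homeomorphic_map (subshift_topology A X) (subshift_topology A X) shift"
proof -
  have cl: "closedin (full_shift A) X" and inv: "shift ` X = X"
    using assms(2) by (auto simp: subshift_def)
  show top: "topspace (subshift_topology A X) = X"
    using closedin_subset[OF cl] by auto
  have "compact_space (full_shift A)"
    unfolding full_shift_def compact_space_product_topology
    using assms(1) by (simp add: compact_space_discrete_topology)
  then show "compact_space (subshift_topology A X)"
    using cl closedin_compact_space compact_space_subtopology by blast
  have "metrizable_space (full_shift A)"
    unfolding full_shift_def metrizable_space_product_topology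
    by (auto simp: metrizable_space_discrete_topology)
  then show "metrizable_space (subshift_topology A X)"
    by (rule metrizable_space_subtopology)
  have un: "(\<lambda>i. shift x (i - 1)) = x" "shift (\<lambda>i. x (i - 1)) = x" for x :: "int \<Rightarrow> 'a"
    by (simp_all add: shift_def)
  have inv': "(\<lambda>i. x (i - 1)) \<in> X" if "x \<in> X" for x
  proof -
    obtain y where "y \<in> X" "x = shift y" using inv \<open>x \<in> X\<close> by blast
    then show ?thesis by (simp add: un)
  qed
  have "homeomorphic_maps (subshift_topology A X) (subshift_topology A X)
          shift (\<lambda>x i. x (i - 1))"
    unfolding homeomorphic_maps_def continuous_map_in_subtopology top
    using inv inv' un
    by (auto intro!: continuous_map_from_subtopology continuous_map_shift continuous_map_unshift)
  then show "homeomorphic_map (subshift_topology A X) (subshift_topology A X) shift"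
    by (rule homeomorphic_maps_imp_map)
qed


section \<open>Words, rays and follower sets\<close>

text \<open>\<open>block x i l\<close> is the word \<open>x\<^sub>i \<dots> x\<^sub>i\<^sub>+\<^sub>l\<^sub>-\<^sub>1\<close>.\<close>

definition block :: "(int \<Rightarrow> 'a) \<Rightarrow> int \<Rightarrow> nat \<Rightarrow> 'a list" where
  "block x i l = map (\<lambda>k. x (i + int k)) [0..<l]"

definition language :: "(int \<Rightarrow> 'a) set \<Rightarrow> 'a list set" where
  "language X = {block x i l | x i l. x \<in> X}"

text \<open>Rays keep the coordinates of the point they come from: they are functions on \<open>int\<close> that
  are \<open>undefined\<close> outside \<open>(-\<infinity>, 0]\<close> and \<open>(0, \<infinity>)\<close>, respectively.\<close>

definition left_ray :: "(int \<Rightarrow> 'a) \<Rightarrow> (int \<Rightarrow> 'a)" where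
  "left_ray x = restrict x {..0}"

definition right_ray :: "(int \<Rightarrow> 'a) \<Rightarrow> (int \<Rightarrow> 'a)" where
  "right_ray x = restrict x {0<..}"

definition left_rays :: "(int \<Rightarrow> 'a) set \<Rightarrow> (int \<Rightarrow> 'a) set" where
  "left_rays X = left_ray ` X"

definition right_rays :: "(int \<Rightarrow> 'a) set \<Rightarrow> (int \<Rightarrow> 'a) set" where
  "right_rays X = right_ray ` X"

text \<open>The condition \<open>i + |w| \<le> 1\<close> says that the last position \<open>i + |w| - 1\<close> is at most \<open>0\<close>.\<close>

definition left_transitive :: "(int \<Rightarrow> 'a) set \<Rightarrow> (int \<Rightarrow> 'a) \<Rightarrow> bool" where
  "left_transitive X \<xi> \<longleftrightarrow>
     (\<forall>w\<in>language X. \<exists>i. i + int (length w) \<le> 1 \<and> block \<xi> i (length w) = w)"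

text \<open>In both follower sets \<open>j\<close> is the coordinate of the point \<open>z\<close> at which the word or left ray
  ends, so that the right ray occupies \<open>(j, \<infinity>)\<close>.\<close>

definition follower_word :: "(int \<Rightarrow> 'a) set \<Rightarrow> 'a list \<Rightarrow> (int \<Rightarrow> 'a) set" where
  "follower_word X w =
     {y \<in> right_rays X. \<exists>z\<in>X. \<exists>j.
        block z (j - int (length w) + 1) (length w) = w \<and> (\<forall>i>0. z (j + i) = y i)}"

definition follower_ray :: "(int \<Rightarrow> 'a) set \<Rightarrow> (int \<Rightarrow> 'a) \<Rightarrow> (int \<Rightarrow> 'a) set" where
  "follower_ray X \<xi> =
     {y \<in> right_rays X. \<exists>z\<in>X. \<exists>j.
        (\<forall>i\<le>0. z (j + i) = \<xi> i) \<and> (\<forall>i>0. z (j + i) = y i)}"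

definition half_synchronized :: "'a set \<Rightarrow> (int \<Rightarrow> 'a) set \<Rightarrow> bool" where
  "half_synchronized A X \<longleftrightarrow>
     subshift A X \<and> transitive_system (subshift_topology A X) shift \<and>
     (\<exists>m\<in>language X. \<exists>\<xi>\<in>left_rays X.
        left_transitive X \<xi> \<and>
        block \<xi> (- int (length m) + 1) (length m) = m \<and>
        follower_ray X \<xi> = follower_word X m)"

end

theory Submission
  imports Defs
begin

text \<open>
  Let \<open>m\<close> be a half-synchronizing word with left transitive ray \<open>\<xi>\<close>. Every sufficiently long suffix
  of \<open>\<xi>\<close> has the same followers as \<open>m\<close>. Call \<open>r\<close> a loop if \<open>m r\<close> and \<open>m\<close> have the same followers;
  loops form a monoid, and \<open>r\<close> is a loop whenever \<open>m r\<close> is a suffix of \<open>\<xi>\<close>, so every word of the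
  language occurs in some loop. If \<open>m\<close> reappears at distance \<open>t\<close>, then the word witnessing this
  occurs in \<open>\<xi>\<close>, and comparing the suffixes of \<open>\<xi>\<close> that start at the two occurrences of \<open>m\<close> gives
  loops whose lengths differ by \<open>t\<close>. Mixing and strong property \<open>P\<close> each provide two consecutive such
  distances, hence loops of two consecutive lengths, hence loops of every large length. Inserting
  loops as fillers between prescribed words yields both properties in turn.
\<close>

section \<open>Occurrences of words and shift invariance\<close>

text \<open>Covers points and left rays alike, as both are functions on \<open>int\<close>. For a
  ray, the condition that the occurrence ends at a coordinate at most \<open>0\<close> is carried
  separately.\<close>

definition occurs_at :: "(int \<Rightarrow> 'a) \<Rightarrow> int \<Rightarrow> 'a list \<Rightarrow> bool" where
  "occurs_at x i w \<longleftrightarrow> block x i (length w) = w"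

lemma length_block [simp]: "length (block x i l) = l"
  by (simp add: block_def)

lemma nth_block [simp]: "k < l \<Longrightarrow> block x i l ! k = x (i + int k)"
  by (simp add: block_def)

lemma occurs_at_iff_nth: "occurs_at x i w \<longleftrightarrow> (\<forall>k<length w. x (i + int k) = w ! k)"
  by (auto simp: occurs_at_def list_eq_iff_nth_eq)

lemma occurs_at_block: "occurs_at x i (block x i l)"
  by (simp add: occurs_at_def)

lemma block_append: "block x i (k + l) = block x i k @ block x (i + int k) l"
  by (rule nth_equalityI) (auto simp: nth_append)

lemma occurs_at_append:
  "occurs_at x i (u @ v) \<longleftrightarrow> occurs_at x i u \<and> occurs_at x (i + int (length u)) v"
  by (simp add: occurs_at_def block_append)

lemma occurs_at_translate: "occurs_at (\<lambda>i. x (i + k)) i w \<longleftrightarrow> occurs_at x (i + k) w"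
  by (simp add: occurs_at_iff_nth algebra_simps)

lemma occurs_at_block_iff:
  "occurs_at y i (block x j l) \<longleftrightarrow> (\<forall>k<l. y (i + int k) = x (j + int k))"
  by (simp add: occurs_at_iff_nth)

lemma funpow_shift: "(shift ^^ n) x = (\<lambda>i. x (i + int n))"
  by (induction n) (auto simp: shift_def algebra_simps)

lemma shift_invariant_translate:
  assumes "shift ` X = X" "x \<in> X"
  shows "(\<lambda>i. x (i + k)) \<in> X"
proof -
  have fwd: "(\<lambda>i. y (i + int n)) \<in> X" if "y \<in> X" for y n
  proof -
    have "(shift ^^ n) y \<in> X"
      by (induction n) (use that assms(1) in auto)
    then show ?thesis by (simp add: funpow_shift)
  qed
  \<comment> \<open>Surjectivity of the shift on \<open>X\<close> enters here: each backward step
    needs a preimage inside \<open>X\<close>.\<close>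
  have bwd: "(\<lambda>i. y (i - int n)) \<in> X" if "y \<in> X" for y n
  proof (induction n)
    case (Suc n)
    then obtain z where z: "z \<in> X" "(\<lambda>i. y (i - int n)) = shift z"
      using assms(1) by (metis imageE)
    have "z i = y (i - int (Suc n))" for i
      using fun_cong[OF z(2), of "i - 1"] by (simp add: shift_def algebra_simps)
    then show ?case using z(1) by (metis ext)
  qed (use that in simp)
  show ?thesis
  proof (cases "0 \<le> k")
    case True
    then show ?thesis using fwd[OF assms(2), of "nat k"] by simp
  next
    case False
    then show ?thesis using bwd[OF assms(2), of "nat (- k)"] by simp
  qed
qed

section \<open>Cylinders\<close>

lemma openin_cylinder:
  "openin (subshift_topology A X) {x \<in> topspace (subshift_topology A X). occurs_at x i w}"
proof -
  have coord: "openin (full_shift A) {x \<in> topspace (full_shift A). x j = a}" for j a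
  proof -
    have "continuous_map (full_shift A) (discrete_topology A) (\<lambda>x. x j)"
      unfolding full_shift_def by (rule continuous_map_product_projection) simp
    \<comment> \<open>The open sets of \<open>discrete_topology A\<close> are subsets of
      \<open>A\<close>; intersecting with \<open>A\<close> also treats a letter \<open>a\<close>
      outside \<open>A\<close>.\<close>
    from openin_continuous_map_preimage[OF this, of "{a} \<inter> A"]
    have "openin (full_shift A) {x \<in> topspace (full_shift A). x j \<in> {a} \<inter> A}" by simp
    moreover have "{x \<in> topspace (full_shift A). x j \<in> {a} \<inter> A} = {x \<in> topspace (full_shift A). x j = a}"
      by (auto simp: topspace_full_shift)
    ultimately show ?thesis by simp
  qed
  have "openin (full_shift A) {x \<in> topspace (full_shift A). occurs_at x i w}"
  proof (induction w rule: rev_induct)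
    case Nil
    then show ?case by (simp add: occurs_at_iff_nth)
  next
    case (snoc a w)
    have "{x \<in> topspace (full_shift A). occurs_at x i (w @ [a])} =
          {x \<in> topspace (full_shift A). occurs_at x i w} \<inter>
          {x \<in> topspace (full_shift A). x (i + int (length w)) = a}"
      by (auto simp: occurs_at_append) (auto simp: occurs_at_iff_nth)
    then show ?case using snoc coord by (simp add: openin_Int)
  qed
  then have "openin (subshift_topology A X) (X \<inter> {x \<in> topspace (full_shift A). occurs_at x i w})"
    by (rule openin_subtopology_Int2)
  also have "X \<inter> {x \<in> topspace (full_shift A). occurs_at x i w} =
             {x \<in> topspace (subshift_topology A X). occurs_at x i w}" by auto
  finally show ?thesis .
qed

text \<open>A basic box around \<open>x\<close> restricts finitely many coordinates, all of which
  lie in a central window. Allowing every \<open>l \<ge> L\<close> lets several open sets share one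
  window.\<close>

lemma cylinder_neighbourhood:
  assumes "openin (subshift_topology A X) U" "x \<in> U"
  obtains L where "\<And>l y. l \<ge> L \<Longrightarrow> y \<in> topspace (subshift_topology A X) \<Longrightarrow>
    occurs_at y (- int l) (block x (- int l) (2 * l + 1)) \<Longrightarrow> y \<in> U"
proof -
  obtain V where V: "openin (full_shift A) V" "U = V \<inter> X"
    using assms(1) by (auto simp: openin_subtopology)
  obtain B where B: "finite {i. B i \<noteq> A}" "x \<in> Pi\<^sub>E UNIV B" "Pi\<^sub>E UNIV B \<subseteq> V"
    using V assms(2) unfolding full_shift_def openin_product_topology_alt by force
  obtain L :: nat where L: "\<And>i. i \<in> {i. B i \<noteq> A} \<Longrightarrow> \<bar>i\<bar> \<le> int L"
  proof
    fix i assume i: "i \<in> {i. B i \<noteq> A}"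
    have "nat \<bar>i\<bar> \<le> Max ((\<lambda>i. nat \<bar>i\<bar>) ` {i. B i \<noteq> A})"
      by (rule Max_ge) (use B(1) i in auto)
    then show "\<bar>i\<bar> \<le> int (Max ((\<lambda>i. nat \<bar>i\<bar>) ` {i. B i \<noteq> A}))" by linarith
  qed
  show thesis
  proof
    fix l y
    assume l: "l \<ge> L" and y: "y \<in> topspace (subshift_topology A X)"
      and occ: "occurs_at y (- int l) (block x (- int l) (2 * l + 1))"
    have "y i \<in> B i" for i
    proof (cases "B i = A")
      case True
      then show ?thesis using y by (auto simp: topspace_full_shift)
    next
      case False
      then have "\<bar>i\<bar> \<le> int l" using L[of i] l by auto
      then have "nat (i + int l) < 2 * l + 1" "- int l + int (nat (i + int l)) = i" by linarith+
      then have "y i = x i" using occ unfolding occurs_at_block_iff by metis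
      then show ?thesis using B(2) by auto
    qed
    then have "y \<in> V" using B(3) by auto
    then show "y \<in> U" using V(2) y by auto
  qed
qed

section \<open>Loops of a half-synchronized system\<close>

text \<open>Write \<open>k = q * n + r\<close> with \<open>r < n\<close>. If
  \<open>k \<ge> n * n\<close>, then \<open>r \<le> q\<close>, so
  \<open>k = (q - r) * n + r * (n + 1)\<close>. For \<open>n = 0\<close> the element
  \<open>1\<close> already generates everything.\<close>

lemma nat_submonoid_consecutive:
  fixes S :: "nat set"
  assumes zero: "0 \<in> S" and add: "\<And>a b. a \<in> S \<Longrightarrow> b \<in> S \<Longrightarrow> a + b \<in> S"
    and n: "n \<in> S" "n + 1 \<in> S"
  obtains K where "\<And>k. k \<ge> K \<Longrightarrow> k \<in> S"
proof
  have mult: "q * a \<in> S" if "a \<in> S" for q a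
    by (induction q) (use zero add that in auto)
  fix k assume k: "k \<ge> n * n"
  show "k \<in> S"
  proof (cases "n = 0")
    case True
    then show ?thesis using mult[OF n(2), of k] by simp
  next
    case False
    have "k mod n \<le> n" using False by (simp add: less_imp_le)
    also have "n \<le> k div n" using k False by (simp add: less_eq_div_iff_mult_less_eq)
    finally have "k = (k div n - k mod n) * n + (k mod n) * (n + 1)"
      by (simp add: algebra_simps diff_mult_distrib2 mult_le_mono)
    then show ?thesis using add[OF mult[OF n(1)] mult[OF n(2)]] by metis
  qed
qed

text \<open>Isolates the combinatorics of \<open>m\<close> and \<open>\<xi>\<close> from the
  topology. The position \<open>1 - int (length m)\<close> makes \<open>m\<close> end at coordinate
  \<open>0\<close>.\<close>

locale half_synchronizing_word =
  fixes X :: "(int \<Rightarrow> 'a) set" and m :: "'a list" and \<xi> :: "int \<Rightarrow> 'a"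
  assumes invariant: "shift ` X = X"
    and transitive_ray: "left_transitive X \<xi>"
    and word_in_language: "m \<in> language X"
    and ray_ends: "occurs_at \<xi> (1 - int (length m)) m"
    and same_followers: "follower_ray X \<xi> = follower_word X m"
begin

text \<open>Followers are tested on finite words \<open>v\<close> instead of right rays: closure
  under concatenation is then plain rewriting, and \<open>v = []\<close> yields membership in the
  language.\<close>

definition loops :: "'a list set" where
  "loops = {r. \<forall>v. m @ r @ v \<in> language X \<longleftrightarrow> m @ v \<in> language X}"

text \<open>Shift invariance moves an occurrence to any prescribed position \<open>i\<close>, which
  is how points are positioned below.\<close>

lemma language_iff: "w \<in> language X \<longleftrightarrow> (\<exists>x\<in>X. occurs_at x i w)"
proof
  assume "w \<in> language X"
  then obtain x j where x: "x \<in> X" "occurs_at x j w"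
    unfolding language_def using occurs_at_block by blast
  then have "occurs_at (\<lambda>k. x (k + (j - i))) i w" by (simp add: occurs_at_translate)
  then show "\<exists>x\<in>X. occurs_at x i w"
    using shift_invariant_translate[OF invariant x(1)] by blast
next
  assume "\<exists>x\<in>X. occurs_at x i w"
  then show "w \<in> language X"
    unfolding language_def occurs_at_def by (metis (mono_tags, lifting) mem_Collect_eq)
qed

section \<open>Suffixes of the transitive ray and loops\<close>

lemma occurs_at_in_language: "x \<in> X \<Longrightarrow> occurs_at x i w \<Longrightarrow> w \<in> language X"
  using language_iff by blast

lemma language_suffix: "u @ v \<in> language X \<Longrightarrow> v \<in> language X"
proof -
  assume "u @ v \<in> language X"
  then obtain x where "x \<in> X" "occurs_at x 0 (u @ v)" using language_iff by blast
  then show "v \<in> language X" unfolding occurs_at_append using occurs_at_in_language by blast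
qed

text \<open>A right ray following \<open>m\<close> also follows the whole of \<open>\<xi>\<close>,
  because the two follower sets agree; hence it follows the suffix \<open>p @ m\<close> of
  \<open>\<xi>\<close>.\<close>

lemma followers_of_suffix:
  assumes "occurs_at \<xi> (1 - int (length (p @ m))) (p @ m)"
  shows "p @ m @ v \<in> language X \<longleftrightarrow> m @ v \<in> language X"
proof
  assume "p @ m @ v \<in> language X"
  then show "m @ v \<in> language X" by (rule language_suffix)
next
  assume "m @ v \<in> language X"
  then obtain z where z: "z \<in> X" "occurs_at z (1 - int (length m)) (m @ v)"
    using language_iff by blast
  \<comment> \<open>In \<open>z\<close> the word \<open>m\<close> ends at coordinate
    \<open>0\<close>, so \<open>j = 0\<close> witnesses membership in the follower set.\<close>
  have "right_ray z \<in> follower_word X m"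
    using z(1) z(2)[unfolded occurs_at_append]
    by (auto simp: follower_word_def right_rays_def right_ray_def occurs_at_def
        intro!: bexI[of _ z] exI[of _ 0])
  then obtain y j where y: "y \<in> X" "\<And>i. i \<le> 0 \<Longrightarrow> y (j + i) = \<xi> i" "\<And>i. i > 0 \<Longrightarrow> y (j + i) = z i"
    unfolding same_followers[symmetric] by (auto simp: follower_ray_def right_ray_def)
  have "occurs_at y (j + (1 - int (length (p @ m)))) (p @ m)"
    using assms y(2) unfolding occurs_at_iff_nth by (force simp: add.assoc)
  moreover have "occurs_at y (j + 1) v"
    using z(2) y(3) unfolding occurs_at_append by (simp add: occurs_at_iff_nth add.assoc)
  ultimately have "occurs_at y (j + (1 - int (length (p @ m)))) ((p @ m) @ v)"
    unfolding occurs_at_append[of _ _ "p @ m"] by (simp add: algebra_simps)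
  then show "p @ m @ v \<in> language X" using occurs_at_in_language[OF y(1)] by simp
qed

text \<open>Extend \<open>w\<close> by \<open>n\<close> letters to the right inside some point. An
  occurrence of the extension in \<open>\<xi>\<close> leaves at least \<open>n\<close> coordinates
  of the ray after \<open>w\<close>.\<close>

lemma occurs_far_left:
  assumes "w \<in> language X"
  obtains i where "i + int (length w) + int n \<le> 1" "occurs_at \<xi> i w"
proof -
  obtain x where x: "x \<in> X" "occurs_at x 0 w" using assms language_iff by blast
  have "w @ block x (int (length w)) n \<in> language X" (is "?w \<in> _")
    by (rule occurs_at_in_language[OF x(1), of 0])
      (use x(2) in \<open>simp add: occurs_at_append occurs_at_block\<close>)
  then obtain i where "i + int (length ?w) \<le> 1" "occurs_at \<xi> i ?w"
    using transitive_ray by (auto simp: left_transitive_def occurs_at_def)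
  then show thesis using that[of i] by (simp add: occurs_at_append add.assoc)
qed

text \<open>Since \<open>\<xi>\<close> also ends in \<open>m\<close>, the suffix can be read as
  \<open>m @ r = p @ m\<close>, where \<open>p\<close> has the length of \<open>r\<close>;
  \<open>m\<close> may overlap itself. Then \<open>followers_of_suffix\<close> applies to
  \<open>p\<close>.\<close>

lemma suffix_loop:
  assumes "occurs_at \<xi> (1 - int (length (m @ r))) (m @ r)"
  shows "r \<in> loops"
proof -
  let ?s = "m @ r"
  define p where "p = take (length r) ?s"
  have "drop (length r) ?s = m"
  proof -
    have "occurs_at \<xi> (1 - int (length ?s)) (take (length r) ?s @ drop (length r) ?s)"
      using assms unfolding append_take_drop_id .
    moreover have "1 - int (length ?s) + int (length (take (length r) ?s)) = 1 - int (length m)"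
      by simp
    ultimately have "occurs_at \<xi> (1 - int (length m)) (drop (length r) ?s)"
      unfolding occurs_at_append by metis
    moreover have "length (drop (length r) ?s) = length m" by simp
    ultimately show ?thesis using ray_ends unfolding occurs_at_def by metis
  qed
  then have s: "?s = p @ m" unfolding p_def by (metis append_take_drop_id)
  have "occurs_at \<xi> (1 - int (length (p @ m))) (p @ m)" using assms unfolding s .
  note followers = followers_of_suffix[OF this]
  have "m @ r @ v \<in> language X \<longleftrightarrow> m @ v \<in> language X" for v
  proof -
    have "m @ r @ v = p @ m @ v" using arg_cong[OF s, of "\<lambda>u. u @ v"] by simp
    then show ?thesis using followers[of v] by (rule ssubst)
  qed
  then show ?thesis unfolding loops_def by (intro CollectI allI)
qed

lemma suffix_from_occurrence:
  assumes "i + int (length w) \<le> 1" "occurs_at \<xi> i w"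
  obtains c where "occurs_at \<xi> (1 - int (length (w @ c))) (w @ c)"
proof -
  define n where "n = nat (1 - i - int (length w))"
  have "1 - int (length (w @ block \<xi> (i + int (length w)) n)) = i"
    using assms(1) by (simp add: n_def)
  then show thesis
    using that assms(2) by (metis occurs_at_append occurs_at_block)
qed

text \<open>Locate \<open>w\<close> in \<open>\<xi>\<close>, then an \<open>m\<close> wholly to its
  left. Reading from this \<open>m\<close> to coordinate \<open>0\<close> gives a suffix
  \<open>m @ d @ w @ c\<close>.\<close>

lemma occurs_in_loop:
  assumes "w \<in> language X"
  obtains d c where "d @ w @ c \<in> loops"
proof -
  obtain i where i: "i + int (length w) + int 0 \<le> 1" "occurs_at \<xi> i w"
    using occurs_far_left[OF assms] .
  \<comment> \<open>The reserve \<open>nat (1 - i)\<close> forces this occurrence of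
    \<open>m\<close> to end before coordinate \<open>i\<close>, where \<open>w\<close>
    starts.\<close>
  obtain i' where i': "i' + int (length m) + int (nat (1 - i)) \<le> 1" "occurs_at \<xi> i' m"
    using occurs_far_left[OF word_in_language] .
  define d where "d = block \<xi> (i' + int (length m)) (nat (i - i' - int (length m)))"
  have len: "i' + int (length m) + int (length d) = i"
    using i(1) i'(1) by (simp add: d_def)
  then have "occurs_at \<xi> i' (m @ d @ w)"
    using i(2) i'(2) by (simp add: occurs_at_append d_def[symmetric])
      (simp add: d_def occurs_at_block)
  moreover have "i' + int (length (m @ d @ w)) \<le> 1" using len i(1) by simp
  ultimately obtain c where "occurs_at \<xi> (1 - int (length ((m @ d @ w) @ c))) ((m @ d @ w) @ c)"
    using suffix_from_occurrence by blast
  then have "d @ w @ c \<in> loops" using suffix_loop by simp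
  then show thesis using that by blast
qed

section \<open>The monoid of loops and the lengths of its elements\<close>

lemma append_loops: "r \<in> loops \<Longrightarrow> s \<in> loops \<Longrightarrow> r @ s \<in> loops"
  by (simp add: loops_def)

lemma concat_loops: "set rs \<subseteq> loops \<Longrightarrow> concat rs \<in> loops"
proof (induction rs)
  case Nil
  show ?case by (simp add: loops_def)
next
  case (Cons r rs)
  then show ?case by (simp add: append_loops)
qed

lemma loop_in_language: "r \<in> loops \<Longrightarrow> m @ r \<in> language X"
proof -
  assume "r \<in> loops"
  then have "m @ r @ [] \<in> language X \<longleftrightarrow> m @ [] \<in> language X"
    unfolding loops_def mem_Collect_eq by (rule spec)
  then show "m @ r \<in> language X" using word_in_language by simp
qed

text \<open>The two occurrences of \<open>m\<close> give \<open>m @ f = e @ m\<close> with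
  \<open>e\<close> and \<open>f\<close> of length \<open>t\<close>. If \<open>c\<close> continues
  this word to the end of \<open>\<xi>\<close>, then both \<open>m @ f @ c\<close> and
  \<open>m @ c\<close> are suffixes of \<open>\<xi>\<close>, so \<open>f @ c\<close> and
  \<open>c\<close> are loops.\<close>

lemma loops_from_return:
  assumes "x \<in> X" "occurs_at x i m" "occurs_at x (i + int t) m"
  obtains a where "a \<in> length ` loops" "a + t \<in> length ` loops"
proof -
  define f where "f = block x (i + int (length m)) t"
  define e where "e = block x i t"
  have eq: "m @ f = e @ m"
    using assms block_append[of x i "length m" t] block_append[of x i t "length m"]
    by (simp add: e_def f_def occurs_at_def add.commute)
  have "m @ f \<in> language X"
    by (rule occurs_at_in_language[OF assms(1), of i])
      (use assms(2) in \<open>simp add: f_def occurs_at_append occurs_at_block\<close>)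
  then obtain j where "j + int (length (m @ f)) + int 0 \<le> 1" "occurs_at \<xi> j (m @ f)"
    using occurs_far_left by blast
  then obtain c where c: "occurs_at \<xi> (1 - int (length ((m @ f) @ c))) ((m @ f) @ c)"
    using suffix_from_occurrence[of j "m @ f"] by auto
  then have fc: "f @ c \<in> loops" using suffix_loop by simp
  have "occurs_at \<xi> (1 - int (length (e @ m @ c))) (e @ m @ c)"
    using c unfolding eq by simp
  then have "occurs_at \<xi> (1 - int (length (m @ c))) (m @ c)"
    unfolding occurs_at_append[of _ _ e] by (simp add: algebra_simps)
  then have "c \<in> loops" by (rule suffix_loop)
  then show thesis
    using that[of "length c"] fc by (metis image_eqI length_append add.commute f_def length_block)
qed

text \<open>Lengths \<open>a\<close>, \<open>a + t\<close> and \<open>b\<close>,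
  \<open>b + t + 1\<close> combine crosswise to the consecutive lengths \<open>a + t + b\<close> and
  \<open>a + t + b + 1\<close>.\<close>

lemma loops_of_large_length:
  assumes "x \<in> X" "occurs_at x i m" "occurs_at x (i + int t) m"
    and "y \<in> X" "occurs_at y j m" "occurs_at y (j + int (t + 1)) m"
  obtains K where "\<forall>k\<ge>K. \<exists>r\<in>loops. length r = k"
proof -
  obtain a where a: "a \<in> length ` loops" "a + t \<in> length ` loops"
    using loops_from_return[OF assms(1-3)] .
  obtain b where b: "b \<in> length ` loops" "b + (t + 1) \<in> length ` loops"
    using loops_from_return[OF assms(4-6)] .
  have zero: "0 \<in> length ` loops" using concat_loops[of "[]"] by force
  have add: "p + q \<in> length ` loops" if pq: "p \<in> length ` loops" "q \<in> length ` loops" for p q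
  proof -
    obtain r s where "r \<in> loops" "s \<in> loops" "p = length r" "q = length s" using pq by blast
    then show ?thesis using append_loops[of r s] by (intro image_eqI[of _ _ "r @ s"]) simp_all
  qed
  have "(a + t) + b \<in> length ` loops" "(a + t) + b + 1 \<in> length ` loops"
    using add[OF a(2) b(1)] add[OF a(1) b(2)] by (simp_all add: algebra_simps)
  then obtain K where K: "\<And>k. k \<ge> K \<Longrightarrow> k \<in> length ` loops"
    using nat_submonoid_consecutive[OF zero add] by metis
  show thesis by (rule that[of K]) (use K in force)
qed

section \<open>Placing prescribed words with loops as fillers\<close>

text \<open>Put \<open>u\<close> and \<open>w\<close> into loops and separate these by a filler loop
  \<open>e\<close>, whose length adjusts the distance to exactly \<open>n\<close>.\<close>

lemma words_at_all_large_distances: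
  assumes K: "\<forall>k\<ge>K. \<exists>r\<in>loops. length r = k"
    and "u \<in> language X" "w \<in> language X"
  obtains M where "\<And>n. n \<ge> M \<Longrightarrow> \<exists>x\<in>X. occurs_at x i u \<and> occurs_at x (i + int n) w"
proof -
  obtain d c where dc: "d @ u @ c \<in> loops" using occurs_in_loop[OF assms(2)] .
  obtain d' c' where dc': "d' @ w @ c' \<in> loops" using occurs_in_loop[OF assms(3)] .
  show thesis
  proof
    fix n assume n: "n \<ge> K + length u + length c + length d'"
    then have "K \<le> n - length u - length c - length d'" by simp
    then obtain e where e: "e \<in> loops" "length e = n - length u - length c - length d'"
      using K by blast
    have "m @ (d @ u @ c) @ e @ (d' @ w @ c') \<in> language X"
      by (intro loop_in_language append_loops dc dc' e(1))
    then obtain x where x: "x \<in> X"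
      "occurs_at x (i - int (length m) - int (length d)) (m @ (d @ u @ c) @ e @ (d' @ w @ c'))"
      using language_iff by blast
    have "int n = int (length u) + int (length c) + int (length e) + int (length d')"
      using n e(2) by simp
    then have "occurs_at x i u" "occurs_at x (i + int n) w"
      using x(2) unfolding occurs_at_append by (simp_all add: add.assoc)
    then show "\<exists>x\<in>X. occurs_at x i u \<and> occurs_at x (i + int n) w" using x(1) by blast
  qed
qed

text \<open>Each \<open>w i\<close> is put into a loop and padded by filler loops on both sides, to
  total length \<open>N\<close> and with \<open>w i\<close> at offset \<open>P\<close>.
  Concatenations in any order are again loops, so \<open>N\<close> depends neither on
  \<open>k\<close> nor on \<open>s\<close>.\<close>

lemma words_at_common_distance:
  assumes K: "\<forall>k\<ge>K. \<exists>r\<in>loops. length r = k"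
    and "finite I" "\<forall>i\<in>I. w i \<in> language X" "\<forall>i\<in>I. length (w i) = l"
  obtains N where "N \<ge> 1"
    "\<And>s k. \<forall>j<k. s j \<in> I \<Longrightarrow> \<exists>x\<in>X. \<forall>j<k. occurs_at x (p + int (j * N)) (w (s j))"
proof -
  have "\<exists>d c. d @ w i @ c \<in> loops" if "i \<in> I" for i
    using occurs_in_loop[OF bspec[OF assms(3) that]] by metis
  then obtain d c where dc: "\<And>i. i \<in> I \<Longrightarrow> d i @ w i @ c i \<in> loops" by metis
  \<comment> \<open>The sums serve as common upper bounds of the finitely many lengths.\<close>
  define D where "D = (\<Sum>i\<in>I. length (d i))"
  define C where "C = (\<Sum>i\<in>I. length (c i))"
  have D: "length (d i) \<le> D" and C: "length (c i) \<le> C" if "i \<in> I" for i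
    using that assms(2) by (auto simp: D_def C_def intro!: member_le_sum)
  \<comment> \<open>The surplus \<open>K\<close> keeps the filler lengths
    \<open>P - length (d i)\<close> and \<open>C + K + 1 - length (c i)\<close> at least
    \<open>K\<close>, so such loops exist. The extra \<open>1\<close> ensures
    \<open>N \<ge> 1\<close>.\<close>
  define P where "P = K + D"
  define N where "N = P + l + C + K + 1"
  have "\<exists>e\<in>loops. length e = P - length (d i)" if "i \<in> I" for i
    using K[rule_format, of "P - length (d i)"] D[OF that] by (simp add: P_def)
  moreover have "\<exists>g\<in>loops. length g = C + K + 1 - length (c i)" if "i \<in> I" for i
    using K[rule_format, of "C + K + 1 - length (c i)"] C[OF that] by simp
  ultimately obtain e g where
    e: "\<And>i. i \<in> I \<Longrightarrow> e i \<in> loops \<and> length (e i) = P - length (d i)" and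
    g: "\<And>i. i \<in> I \<Longrightarrow> g i \<in> loops \<and> length (g i) = C + K + 1 - length (c i)" by metis
  define R where "R = (\<lambda>i. (e i @ d i) @ w i @ (c i @ g i))"
  have R: "R i \<in> loops" if "i \<in> I" for i
    using append_loops[of "e i" "(d i @ w i @ c i) @ g i"] append_loops[of "d i @ w i @ c i" "g i"]
      e[OF that] g[OF that] dc[OF that] by (simp add: R_def)
  have pre: "length (e i @ d i) = P" if "i \<in> I" for i
    using e[OF that] D[OF that] by (simp add: P_def)
  have lenR: "length (R i) = N" if "i \<in> I" for i
    using pre[OF that] g[OF that] C[OF that] bspec[OF assms(4) that] by (simp add: R_def N_def)
  show thesis
  proof
    show "N \<ge> 1" by (simp add: N_def)
    fix s :: "nat \<Rightarrow> _" and k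
    assume s: "\<forall>j<k. s j \<in> I"
    define rs where "rs = map (\<lambda>j. R (s j)) [0..<k]"
    have "m @ concat rs \<in> language X"
      by (intro loop_in_language concat_loops) (use s R in \<open>auto simp: rs_def\<close>)
    \<comment> \<open>The first padded loop starts at \<open>p - int P\<close>, so its prescribed
      word starts at \<open>p\<close>.\<close>
    then obtain x where x: "x \<in> X" "occurs_at x (p - int P - int (length m)) (m @ concat rs)"
      using language_iff by blast
    have "occurs_at x (p + int (j * N)) (w (s j))" if j: "j < k" for j
    proof -
      have "rs = take j rs @ R (s j) # drop (Suc j) rs"
        using id_take_nth_drop[of j rs] j by (simp add: rs_def)
      then have split: "concat rs = concat (take j rs) @ R (s j) @ concat (drop (Suc j) rs)"
        by (metis concat.simps(2) concat_append)
      have "length (concat (take j rs)) = j * N"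
      proof -
        have "map length (take j rs) = replicate j N"
          using j s lenR by (intro nth_equalityI) (auto simp: rs_def)
        then show ?thesis by (simp add: length_concat sum_list_replicate)
      qed
      then have "occurs_at x (p - int P + int (j * N)) (R (s j))"
        using x(2) unfolding split by (simp add: occurs_at_append)
      then show ?thesis
        using pre[of "s j"] s j unfolding R_def occurs_at_append[of _ _ "e (s j) @ d (s j)"]
          occurs_at_append[of _ _ "w (s j)"] by (simp del: length_append add: algebra_simps)
    qed
    then show "\<exists>x\<in>X. \<forall>j<k. occurs_at x (p + int (j * N)) (w (s j))" using x(1) by blast
  qed
qed

section \<open>From loops to open sets and back\<close>

lemma cylinder_of_word:
  assumes top: "topspace (subshift_topology A X) = X" and w: "w \<in> language X"
  shows "openin (subshift_topology A X) {x \<in> X. occurs_at x i w}"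
    and "{x \<in> X. occurs_at x i w} \<noteq> {}"
proof -
  show "openin (subshift_topology A X) {x \<in> X. occurs_at x i w}"
    using openin_cylinder[of A X i w] unfolding top .
  show "{x \<in> X. occurs_at x i w} \<noteq> {}" using iffD1[OF language_iff w] by blast
qed

text \<open>Central windows of points of \<open>U\<close> and \<open>V\<close> can be placed at
  every large distance. This gives all large positive times, and exchanging \<open>U\<close> and
  \<open>V\<close> gives the negative ones.\<close>

lemma mixing_if_large_loops:
  assumes top: "topspace (subshift_topology A X) = X"
    and K: "\<forall>k\<ge>K. \<exists>r\<in>loops. length r = k"
  shows "mixing_system (subshift_topology A X) shift"
proof -
  have pos: "\<exists>M. \<forall>n\<ge>M. \<exists>x\<in>U. (shift ^^ n) x \<in> V"
    if U: "openin (subshift_topology A X) U" "U \<noteq> {}"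
      and V: "openin (subshift_topology A X) V" "V \<noteq> {}" for U V
  proof -
    obtain a b where ab: "a \<in> U" "b \<in> V" using U(2) V(2) by blast
    have abX: "a \<in> X" "b \<in> X" using ab openin_subset[OF U(1)] openin_subset[OF V(1)] top by auto
    obtain L1 where L1: "\<And>l y. l \<ge> L1 \<Longrightarrow> y \<in> X \<Longrightarrow>
        occurs_at y (- int l) (block a (- int l) (2 * l + 1)) \<Longrightarrow> y \<in> U"
      using cylinder_neighbourhood[OF U(1) ab(1)] unfolding top by metis
    obtain L2 where L2: "\<And>l y. l \<ge> L2 \<Longrightarrow> y \<in> X \<Longrightarrow>
        occurs_at y (- int l) (block b (- int l) (2 * l + 1)) \<Longrightarrow> y \<in> V"
      using cylinder_neighbourhood[OF V(1) ab(2)] unfolding top by metis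
    define l where "l = max L1 L2"
    have lang: "block a (- int l) (2 * l + 1) \<in> language X" "block b (- int l) (2 * l + 1) \<in> language X"
      using abX occurs_at_in_language occurs_at_block by metis+
    obtain M where M: "\<And>n. n \<ge> M \<Longrightarrow> \<exists>x\<in>X. occurs_at x (- int l) (block a (- int l) (2 * l + 1)) \<and>
        occurs_at x (- int l + int n) (block b (- int l) (2 * l + 1))"
      using words_at_all_large_distances[OF K lang, where i = "- int l"] by metis
    have "\<exists>x\<in>U. (shift ^^ n) x \<in> V" if n: "n \<ge> M" for n
    proof -
      obtain x where x: "x \<in> X" "occurs_at x (- int l) (block a (- int l) (2 * l + 1))"
        "occurs_at x (- int l + int n) (block b (- int l) (2 * l + 1))" using M[OF n] by blast
      have "x \<in> U" using L1[of l x] x by (simp add: l_def)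
      moreover have "(shift ^^ n) x \<in> V"
        unfolding funpow_shift
      proof (rule L2)
        show "l \<ge> L2" by (simp add: l_def)
        show "(\<lambda>i. x (i + int n)) \<in> X" by (rule shift_invariant_translate[OF invariant x(1)])
        show "occurs_at (\<lambda>i. x (i + int n)) (- int l) (block b (- int l) (2 * l + 1))"
          using x(3) unfolding occurs_at_translate .
      qed
      ultimately show ?thesis by blast
    qed
    then show ?thesis by blast
  qed
  show ?thesis
    unfolding mixing_system_def
  proof (intro allI impI, elim conjE)
    fix U V
    assume U: "openin (subshift_topology A X) U" "U \<noteq> {}"
      and V: "openin (subshift_topology A X) V" "V \<noteq> {}"
    obtain M1 where M1: "\<And>n. n \<ge> M1 \<Longrightarrow> \<exists>x\<in>U. (shift ^^ n) x \<in> V" using pos[OF U V] by blast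
    obtain M2 where M2: "\<And>n. n \<ge> M2 \<Longrightarrow> \<exists>x\<in>V. (shift ^^ n) x \<in> U" using pos[OF V U] by blast
    have "n \<in> hitting_times (subshift_topology A X) shift U V" if "n \<ge> int M1" for n
    proof -
      have "nat n \<ge> M1" using that by linarith
      then obtain x where "x \<in> U" "(shift ^^ nat n) x \<in> V" using M1 by blast
      then show ?thesis
        using that openin_subset[OF U(1)]
        by (auto simp: hitting_times_def iter_vimage_def)
    qed
    \<comment> \<open>At negative times \<open>iter_vimage\<close> is a forward image, so hitting at
      \<open>n\<close> means an orbit from \<open>V\<close> to \<open>U\<close> of length
      \<open>- n\<close>.\<close>
    moreover have "n \<in> hitting_times (subshift_topology A X) shift U V" if n: "n \<le> - int M2" "n < 0" for n
    proof -
      have "nat (- n) \<ge> M2" using n by linarith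
      then obtain x where "x \<in> V" "(shift ^^ nat (- n)) x \<in> U" using M2 by blast
      then show ?thesis using n by (auto simp: hitting_times_def iter_vimage_def)
    qed
    ultimately have outside: "\<not> n \<ge> int M1 \<and> \<not> (n \<le> - int M2 \<and> n < 0)"
      if "n \<notin> hitting_times (subshift_topology A X) shift U V" for n
      using that by blast
    have "- hitting_times (subshift_topology A X) shift U V \<subseteq> {- int M2 .. int M1}"
    proof
      fix n assume "n \<in> - hitting_times (subshift_topology A X) shift U V"
      then show "n \<in> {- int M2 .. int M1}" using outside[of n] by auto
    qed
    then show "finite (- hitting_times (subshift_topology A X) shift U V)"
      by (rule finite_subset) simp
  qed
qed

text \<open>Each \<open>U i\<close> contains all points of \<open>X\<close> that agree with some
  \<open>a i\<close> on a central window. A common radius \<open>l\<close> makes the window words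
  equally long, so one distance \<open>N\<close> serves all itineraries.\<close>

lemma strong_property_P_if_large_loops:
  assumes top: "topspace (subshift_topology A X) = X"
    and K: "\<forall>k\<ge>K. \<exists>r\<in>loops. length r = k"
  shows "strong_property_P (subshift_topology A X) shift"
  unfolding strong_property_P_def
proof (intro allI impI)
  fix n :: nat and U :: "nat \<Rightarrow> (int \<Rightarrow> 'a) set"
  assume U: "\<forall>i\<in>{1..n}. openin (subshift_topology A X) (U i) \<and> U i \<noteq> {}"
  have "\<exists>a L. a \<in> X \<and> (\<forall>l\<ge>L. \<forall>y\<in>X. occurs_at y (- int l) (block a (- int l) (2 * l + 1)) \<longrightarrow> y \<in> U i)"
    if i: "i \<in> {1..n}" for i
  proof -
    have open_i: "openin (subshift_topology A X) (U i)" using U i by blast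
    obtain a where a: "a \<in> U i" using U i by blast
    obtain L where "\<And>l y. l \<ge> L \<Longrightarrow> y \<in> X \<Longrightarrow>
        occurs_at y (- int l) (block a (- int l) (2 * l + 1)) \<Longrightarrow> y \<in> U i"
      using cylinder_neighbourhood[OF open_i a] unfolding top by metis
    moreover have "a \<in> X" using a openin_subset[OF open_i] top by auto
    ultimately show ?thesis by blast
  qed
  then obtain a L where aL: "\<And>i. i \<in> {1..n} \<Longrightarrow> a i \<in> X"
    "\<And>i l y. i \<in> {1..n} \<Longrightarrow> l \<ge> L i \<Longrightarrow> y \<in> X \<Longrightarrow>
      occurs_at y (- int l) (block (a i) (- int l) (2 * l + 1)) \<Longrightarrow> y \<in> U i" by metis
  define l where "l = (\<Sum>i\<in>{1..n}. L i)"
  have l: "L i \<le> l" if "i \<in> {1..n}" for i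
    unfolding l_def by (rule member_le_sum) (use that in auto)
  define w where "w = (\<lambda>i. block (a i) (- int l) (2 * l + 1))"
  have lang: "\<forall>i\<in>{1..n}. w i \<in> language X"
    using aL(1) occurs_at_in_language occurs_at_block unfolding w_def by metis
  have len: "\<forall>i\<in>{1..n}. length (w i) = 2 * l + 1" by (simp add: w_def)
  obtain N where N: "N \<ge> 1" "\<And>s k. \<forall>j<k. s j \<in> {1..n} \<Longrightarrow>
      \<exists>x\<in>X. \<forall>j<k. occurs_at x (- int l + int (j * N)) (w (s j))"
    using words_at_common_distance[OF K finite_atLeastAtMost lang len, where p = "- int l"] by metis
  have "\<exists>x\<in>topspace (subshift_topology A X). \<forall>j\<in>{1..k}. (shift ^^ ((j - 1) * N)) x \<in> U (s j)"
    if s: "\<forall>j\<in>{1..k}. s j \<in> {1..n}" for k s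
  proof -
    \<comment> \<open>Itineraries are indexed from \<open>1\<close> in the property but from
      \<open>0\<close> in \<open>words_at_common_distance\<close>.\<close>
    have s': "\<forall>j<k. s (Suc j) \<in> {1..n}" using s by auto
    obtain x where x: "x \<in> X" "\<And>j. j < k \<Longrightarrow> occurs_at x (- int l + int (j * N)) (w (s (Suc j)))"
      using N(2)[OF s'] by blast
    have "(shift ^^ ((j - 1) * N)) x \<in> U (s j)" if j: "j \<in> {1..k}" for j
    proof (rule aL(2))
      show sj: "s j \<in> {1..n}" using s j by blast
      show "L (s j) \<le> l" using l[OF sj] .
      show "(shift ^^ ((j - 1) * N)) x \<in> X"
        unfolding funpow_shift by (rule shift_invariant_translate[OF invariant x(1)])
      show "occurs_at ((shift ^^ ((j - 1) * N)) x) (- int l) (block (a (s j)) (- int l) (2 * l + 1))"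
      proof -
        have "j - 1 < k" "Suc (j - 1) = j" using j by auto
        then show ?thesis
          using x(2)[of "j - 1"] unfolding funpow_shift occurs_at_translate by (simp add: w_def)
      qed
    qed
    then show ?thesis using x(1) top by blast
  qed
  then show "\<exists>N::nat. N \<ge> 1 \<and> (\<forall>(k::nat) (s :: nat \<Rightarrow> nat). k \<ge> 2 \<and> (\<forall>j\<in>{1..k}. s j \<in> {1..n}) \<longrightarrow>
      (\<exists>x\<in>topspace (subshift_topology A X). \<forall>j\<in>{1..k}. (shift ^^ ((j - 1) * N)) x \<in> U (s j)))"
    using N(1) by blast
qed

text \<open>Mixing lets the cylinder of \<open>m\<close> hit itself at all large times; two
  consecutive ones feed \<open>loops_of_large_length\<close>.\<close>

lemma large_loops_if_mixing:
  assumes top: "topspace (subshift_topology A X) = X"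
    and mix: "mixing_system (subshift_topology A X) shift"
  obtains K where "\<forall>k\<ge>K. \<exists>r\<in>loops. length r = k"
proof -
  define U where "U = {x \<in> X. occurs_at x 0 m}"
  have "openin (subshift_topology A X) U" "U \<noteq> {}"
    unfolding U_def by (rule cylinder_of_word[OF top word_in_language])+
  then have "finite (- hitting_times (subshift_topology A X) shift U U)" (is "finite (- ?H)")
    using mix unfolding mixing_system_def by blast
  then obtain M where M: "\<And>i. i \<in> - ?H \<Longrightarrow> i \<le> M"
    by (meson bdd_above_def bdd_above_finite)
  \<comment> \<open>Every integer above \<open>M\<close> is a hitting time; \<open>nat\<close>
    replaces a negative \<open>M + 1\<close> by \<open>0\<close>.\<close>
  define t where "t = nat (M + 1)"
  have hit: "\<exists>x\<in>X. occurs_at x 0 m \<and> occurs_at x (0 + int n) m" if "n \<ge> t" for n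
  proof -
    have "int n \<in> ?H" using M[of "int n"] that unfolding t_def Compl_iff by linarith
    then show ?thesis
      by (auto simp: hitting_times_def iter_vimage_def U_def funpow_shift occurs_at_translate)
  qed
  obtain x where x: "x \<in> X" "occurs_at x 0 m" "occurs_at x (0 + int t) m" using hit by blast
  obtain y where y: "y \<in> X" "occurs_at y 0 m" "occurs_at y (0 + int (t + 1)) m"
    using hit[of "t + 1"] by auto
  show thesis using loops_of_large_length[OF x y] that by blast
qed

text \<open>The two open sets are the cylinders of \<open>m\<close> at the adjacent positions \<open>0\<close> and \<open>1\<close>, so that
  the itineraries \<open>(1, 1)\<close> and \<open>(1, 2)\<close> make \<open>m\<close> reappear at distances \<open>N\<close> and \<open>N + 1\<close>.\<close>

lemma large_loops_if_strong_property_P: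
  assumes top: "topspace (subshift_topology A X) = X"
    and P: "strong_property_P (subshift_topology A X) shift"
  obtains K where "\<forall>k\<ge>K. \<exists>r\<in>loops. length r = k"
proof -
  define U where "U = (\<lambda>i::nat. {x \<in> X. occurs_at x (int i - 1) m})"
  have "openin (subshift_topology A X) (U i) \<and> U i \<noteq> {}" for i
    unfolding U_def by (intro conjI cylinder_of_word[OF top word_in_language])
  then have "\<exists>N::nat. N \<ge> 1 \<and>
      (\<forall>(k::nat) (s :: nat \<Rightarrow> nat). k \<ge> 2 \<and> (\<forall>j\<in>{1..k}. s j \<in> {1..2}) \<longrightarrow>
        (\<exists>x\<in>topspace (subshift_topology A X). \<forall>j\<in>{1..k}. (shift ^^ ((j - 1) * N)) x \<in> U (s j)))"
    using spec[OF spec[OF P[unfolded strong_property_P_def], of 2], of U] by blast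
  then obtain N where N: "\<And>k s. k \<ge> 2 \<Longrightarrow> \<forall>j\<in>{1..k}. s j \<in> {1..2} \<Longrightarrow>
      \<exists>x\<in>X. \<forall>j\<in>{1..k}. (shift ^^ ((j - 1) * N)) x \<in> U (s j)" unfolding top by blast
  have hit: "\<exists>x\<in>X. occurs_at x 0 m \<and> occurs_at x (0 + int (N + i)) m" if "i \<in> {0, 1}" for i
  proof -
    have itin: "\<forall>j\<in>{1..2}. (if j = 1 then 1 else i + 1) \<in> {1..2}" using that by auto
    obtain x where x: "x \<in> X"
      "\<forall>j\<in>{1..2}. (shift ^^ ((j - 1) * N)) x \<in> U (if j = 1 then 1 else i + 1)"
      using N[OF order.refl itin] by blast
    \<comment> \<open>\<open>U i\<close> places \<open>m\<close> at \<open>i - 1\<close>, so these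
      memberships put \<open>m\<close> at \<open>0\<close> and at \<open>N + i\<close> in
      \<open>x\<close>.\<close>
    have "x \<in> U 1" "(shift ^^ N) x \<in> U (i + 1)"
      using bspec[OF x(2), of 1] bspec[OF x(2), of 2] by auto
    then show ?thesis
      using x(1) by (auto simp: U_def funpow_shift occurs_at_translate algebra_simps)
  qed
  obtain x where x: "x \<in> X" "occurs_at x 0 m" "occurs_at x (0 + int N) m" using hit[of 0] by auto
  obtain y where y: "y \<in> X" "occurs_at y 0 m" "occurs_at y (0 + int (N + 1)) m"
    using hit[of 1] by auto
  show thesis using loops_of_large_length[OF x y] that by blast
qed

end

theorem corollary3p5:
  fixes A :: "'a set" and X :: "(int \<Rightarrow> 'a) set"
  assumes "finite A"
    and "half_synchronized A X"
  shows "mixing_system (subshift_topology A X) shift \<longleftrightarrow>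
         strong_property_P (subshift_topology A X) shift"
proof -
  have sub: "subshift A X" using assms(2) by (simp add: half_synchronized_def)
  obtain m \<xi> where m: "m \<in> language X" "left_transitive X \<xi>"
    "block \<xi> (- int (length m) + 1) (length m) = m" "follower_ray X \<xi> = follower_word X m"
    using assms(2) unfolding half_synchronized_def by blast
  interpret half_synchronizing_word X m \<xi>
  proof
    show "shift ` X = X" using sub by (simp add: subshift_def)
    have "1 - int (length m) = - int (length m) + 1" by simp
    then show "occurs_at \<xi> (1 - int (length m)) m" unfolding occurs_at_def using m(3) by metis
  qed (fact m)+
  have top: "topspace (subshift_topology A X) = X" by (rule subshift_system(1)[OF assms(1) sub])
  show ?thesis
  proof
    assume "mixing_system (subshift_topology A X) shift"
    then show "strong_property_P (subshift_topology A X) shift"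
      using large_loops_if_mixing[OF top] strong_property_P_if_large_loops[OF top] by metis
  next
    assume "strong_property_P (subshift_topology A X) shift"
    then show "mixing_system (subshift_topology A X) shift"
      using large_loops_if_strong_property_P[OF top] mixing_if_large_loops[OF top] by metis
  qed
qed

end
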